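(* For $k\ge 1$ define the discrete modified energy $$\mathcal E_N(\phi^{k+1},\phi^k,r^{k+1},r^k):=\frac14\Big(\|L_N^{1/2}\phi^{k+1}\|_2^2+\|L_N^{1/2}(2\phi^{k+1}-\phi^k)\|_2^2\Big)+\frac12\Big(|r^{k+1}|^2+|2r^{k+1}-r^k|^2\Big).$$ Then, for every time step $\Delta t>0$, the solution $(\phi^k,r^k)$ of the numerical scheme (SAV), given in the context, satisfies the dissipation property $$\mathcal E_N(\phi^{k+1},\phi^k,r^{k+1},r^k)\le\mathcal E_N(\phi^k,\phi^{k-1},r^k,r^{k-1}).$$
   Context: Let $\Omega=(0,1)^3$ ($|\Omega|=1$), $N=2K+1$ with $K\in\mathbb N$, $h=1/N$, grid points $(x_i,y_j,z_k)=(ih,jh,kh)$. $\mathcal G_N$ is the space of real grid functions $f:\mathbb Z^3\to\mathbb R$ that are $N$-periodic in each index. For $f,g\in\mathcal G_N$: $\langle f,g\rangle=h^3\sum_{i,j,k=0}^{N-1}f_{i,j,k}g_{i,j,k}$, $\|f\|_p=(h^3\sum_{i,j,k=0}^{N-1}|f_{i,j,k}|^p)^{1/p}$ (for vector-valued grid functions $|\cdot|$ is the Euclidean norm). Every $f\in\mathcal G_N$ has the discrete Fourier expansion $f_{i,j,k}=\sum_{\ell,m,n=-K}^K\hat f^N_{\ell,m,n}e^{2\pi\mathrm i(\ell x_i+my_j+nz_k)}$. The Fourier pseudo-spectral derivative $\mathcal D_x$ multiplies $\hat f^N_{\ell,m,n}$ by $2\pi\mathrm i\ell$ (similarly $\mathcal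 D_y,\mathcal D_z$ with $m,n$); $\nabla_N f=(\mathcal D_xf,\mathcal D_yf,\mathcal D_zf)^T$, $\nabla_N\cdot(f_1,f_2,f_3)^T=\mathcal D_xf_1+\mathcal D_yf_2+\mathcal D_zf_3$, $\Delta_N=\nabla_N\cdot\nabla_N$. The constant $a=1-\varepsilon$, $0<\varepsilon<1$, is a fixed parameter, so $0<a<1$. Define $N_N(\phi)=-\nabla_N\cdot(|\nabla_N\phi|^2\nabla_N\phi)+2\Delta_N\phi$ (pointwise products), $L_N\phi=a\phi+\Delta_N^2\phi$, and $E_{1,N}(\phi)=\frac14\|\nabla_N\phi\|_4^4-\|\nabla_N\phi\|_2^2+2|\Omega|$. The operator $L_N^{1/2}$ multiplies $\hat f^N_{\ell,m,n}$ by $(a+\lambda_{\ell,m,n}^2)^{1/2}$, where $\lambda_{\ell,m,n}=4\pi^2(\ell^2+m^2+n^2)$. Scheme (SAV): given $\phi^n,\phi^{n-1}\in\mathcal G_N$ and $r^n,r^{n-1}\in\mathbb R$, with $\hat\phi^{n+1}=2\phi^n-\phi^{n-1}$, find $\phi^{n+1}\in\mathcal G_N$, $r^{n+1}\in\mathbb R$ such that $$\frac{\frac32\phi^{n+1}-2\phi^n+\frac12\phi^{n-1}}{\Delta t}=\Delta_N\Big(\frac{r^{n+1}}{\sqrt{E_{1,N}(\hat\phi^{n+1})}}N_N(\hat\phi^{n+1})+L_N\phi^{n+1}\Big),$$ $$\frac{\frac32r^{n+1}-2r^n+\frac12r^{n-1}}{\Delta t}=\frac{1}{2\sqrt{E_{1,N}(\hat\phi^{n+1})}}\Big\langle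 N_N(\hat\phi^{n+1}),\frac{\frac32\phi^{n+1}-2\phi^n+\frac12\phi^{n-1}}{\Delta t}\Big\rangle,$$ for $n\ge0$, started from $\phi^0\in\mathcal G_N$, $\phi^{-1}=\phi^0-\Delta t\,\Delta_N\mu^0$ with $\mu^0=-\nabla_N\cdot(|\nabla_N\phi^0|^2\nabla_N\phi^0)+a\phi^0+2\Delta_N\phi^0+\Delta_N^2\phi^0$, $r^0=\sqrt{E_{1,N}(\phi^0)}$, $r^{-1}=\sqrt{E_{1,N}(\phi^{-1})}$. *)

theory Defs
  imports "HOL-Analysis.Analysis"
begin

type_synonym 'b grid_fun = "int \<Rightarrow> int \<Rightarrow> int \<Rightarrow> 'b"

definition num :: "nat \<Rightarrow> nat"
  where "num K = 2 * K + 1"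

definition mesh :: "nat \<Rightarrow> real"
  where "mesh K = 1 / real (num K)"

definition grid_space :: "nat \<Rightarrow> real grid_fun set"
  where "grid_space K = {f. \<forall>i j k.
    f (i + int (num K)) j k = f i j k \<and>
    f i (j + int (num K)) k = f i j k \<and>
    f i j (k + int (num K)) = f i j k}"

definition grid_sum :: "nat \<Rightarrow> 'b::comm_monoid_add grid_fun \<Rightarrow> 'b"
  where "grid_sum K f =
    (\<Sum>i\<in>{0..<int (num K)}. \<Sum>j\<in>{0..<int (num K)}. \<Sum>k\<in>{0..<int (num K)}. f i j k)"

definition freq_sum :: "nat \<Rightarrow> 'b::comm_monoid_add grid_fun \<Rightarrow> 'b"
  where "freq_sum K F =
    (\<Sum>l\<in>{- int K..int K}. \<Sum>m\<in>{- int K..int K}. \<Sum>n\<in>{- int K..int K}. F l m n)"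

definition grid_inner :: "nat \<Rightarrow> real grid_fun \<Rightarrow> real grid_fun \<Rightarrow> real"
  where "grid_inner K f g = mesh K ^ 3 * grid_sum K (\<lambda>i j k. f i j k * g i j k)"

definition grid_norm :: "nat \<Rightarrow> real \<Rightarrow> 'b::real_normed_vector grid_fun \<Rightarrow> real"
  where "grid_norm K p f =
    (mesh K ^ 3 * grid_sum K (\<lambda>i j k. norm (f i j k) powr p)) powr (1 / p)"

definition wave :: "nat \<Rightarrow> int \<Rightarrow> int \<Rightarrow> int \<Rightarrow> complex grid_fun"
  where "wave K l m n i j k =
    exp (2 * of_real pi * \<i> * of_real
      (of_int l * (of_int i * mesh K) + of_int m * (of_int j * mesh K)
        + of_int n * (of_int k * mesh K)))"

text \<open>The coefficients of the discrete Fourier expansion; that they do expand every periodic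
  grid function is lemma \<open>fourier_expansion\<close> below.\<close>

definition fourier_coeff :: "nat \<Rightarrow> real grid_fun \<Rightarrow> complex grid_fun"
  where "fourier_coeff K f l m n =
    of_real (mesh K ^ 3) * grid_sum K (\<lambda>i j k. of_real (f i j k) * cnj (wave K l m n i j k))"

text \<open>Taking \<open>Re\<close> only changes the type: by lemma \<open>fourier_mult_complex\<close> below the sum is
  already real for all symbols used here, because the frequency range is symmetric.\<close>

definition fourier_mult :: "nat \<Rightarrow> complex grid_fun \<Rightarrow> real grid_fun \<Rightarrow> real grid_fun"
  where "fourier_mult K \<sigma> f i j k =
    Re (freq_sum K (\<lambda>l m n. \<sigma> l m n * fourier_coeff K f l m n * wave K l m n i j k))"

definition Dx :: "nat \<Rightarrow> real grid_fun \<Rightarrow> real grid_fun"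
  where "Dx K = fourier_mult K (\<lambda>l m n. 2 * of_real pi * \<i> * of_int l)"

definition Dy :: "nat \<Rightarrow> real grid_fun \<Rightarrow> real grid_fun"
  where "Dy K = fourier_mult K (\<lambda>l m n. 2 * of_real pi * \<i> * of_int m)"

definition Dz :: "nat \<Rightarrow> real grid_fun \<Rightarrow> real grid_fun"
  where "Dz K = fourier_mult K (\<lambda>l m n. 2 * of_real pi * \<i> * of_int n)"

definition grid_grad :: "nat \<Rightarrow> real grid_fun \<Rightarrow> (real ^ 3) grid_fun"
  where "grid_grad K f i j k = vector [Dx K f i j k, Dy K f i j k, Dz K f i j k]"

definition grid_div :: "nat \<Rightarrow> (real ^ 3) grid_fun \<Rightarrow> real grid_fun"
  where "grid_div K v i j k =
    Dx K (\<lambda>i j k. v i j k $ 1) i j k + Dy K (\<lambda>i j k. v i j k $ 2) i j k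
      + Dz K (\<lambda>i j k. v i j k $ 3) i j k"

definition grid_lap :: "nat \<Rightarrow> real grid_fun \<Rightarrow> real grid_fun"
  where "grid_lap K f = grid_div K (grid_grad K f)"

definition four_laplacian :: "nat \<Rightarrow> real grid_fun \<Rightarrow> real grid_fun"
  where "four_laplacian K f =
    grid_div K (\<lambda>i j k. (norm (grid_grad K f i j k))\<^sup>2 *\<^sub>R grid_grad K f i j k)"

definition nonlin :: "nat \<Rightarrow> real grid_fun \<Rightarrow> real grid_fun"
  where "nonlin K f i j k = - four_laplacian K f i j k + 2 * grid_lap K f i j k"

definition lin :: "nat \<Rightarrow> real \<Rightarrow> real grid_fun \<Rightarrow> real grid_fun"
  where "lin K a f i j k = a * f i j k + grid_lap K (grid_lap K f) i j k"

definition lambda :: "int \<Rightarrow> int \<Rightarrow> int \<Rightarrow> real"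
  where "lambda l m n = 4 * pi\<^sup>2 * of_int (l\<^sup>2 + m\<^sup>2 + n\<^sup>2)"

definition lin_sqrt :: "nat \<Rightarrow> real \<Rightarrow> real grid_fun \<Rightarrow> real grid_fun"
  where "lin_sqrt K a = fourier_mult K (\<lambda>l m n. of_real (sqrt (a + (lambda l m n)\<^sup>2)))"

text \<open>The final summand is \<open>2 |\<Omega>|\<close>, where \<open>\<Omega>\<close> is the open unit cube and \<open>|\<Omega>| = 1\<close>.\<close>

definition E1 :: "nat \<Rightarrow> real grid_fun \<Rightarrow> real"
  where "E1 K f =
    1 / 4 * (grid_norm K 4 (grid_grad K f)) ^ 4 - (grid_norm K 2 (grid_grad K f))\<^sup>2 + 2 * 1"

text \<open>The second-order backward difference quotient and extrapolation; the arguments are the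
  new, current and old values, respectively the current and old values.\<close>

definition bdf2 :: "real \<Rightarrow> real \<Rightarrow> real \<Rightarrow> real \<Rightarrow> real"
  where "bdf2 dt u v w = (3 / 2 * u - 2 * v + 1 / 2 * w) / dt"

definition extrapolate :: "real grid_fun \<Rightarrow> real grid_fun \<Rightarrow> real grid_fun"
  where "extrapolate f g i j k = 2 * f i j k - g i j k"

text \<open>In \<open>sav_step K a dt \<phi>' \<phi> \<psi> r' r s\<close> the unknowns are \<open>\<phi>'\<close>, \<open>r'\<close>, the current values
  \<open>\<phi>\<close>, \<open>r\<close> and the previous ones \<open>\<psi>\<close>, \<open>s\<close>.\<close>

definition sav_step ::
  "nat \<Rightarrow> real \<Rightarrow> real \<Rightarrow> real grid_fun \<Rightarrow> real grid_fun \<Rightarrow> real grid_fun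
    \<Rightarrow> real \<Rightarrow> real \<Rightarrow> real \<Rightarrow> bool"
  where "sav_step K a dt \<phi>' \<phi> \<psi> r' r s \<longleftrightarrow>
    (let \<phi>h = extrapolate \<phi> \<psi>;
         d\<phi> = (\<lambda>i j k. bdf2 dt (\<phi>' i j k) (\<phi> i j k) (\<psi> i j k))
     in d\<phi> = grid_lap K (\<lambda>i j k. r' / sqrt (E1 K \<phi>h) * nonlin K \<phi>h i j k + lin K a \<phi>' i j k) \<and>
        bdf2 dt r' r s = 1 / (2 * sqrt (E1 K \<phi>h)) * grid_inner K (nonlin K \<phi>h) d\<phi>)"

definition init_potential :: "nat \<Rightarrow> real \<Rightarrow> real grid_fun \<Rightarrow> real grid_fun"
  where "init_potential K a f i j k =
    - four_laplacian K f i j k + a * f i j k + 2 * grid_lap K f i j k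
      + grid_lap K (grid_lap K f) i j k"

text \<open>Time levels are integers so that the starting level is literally \<open>-1\<close>; values at levels
  below \<open>-1\<close> are unconstrained.\<close>

definition sav_solution ::
  "nat \<Rightarrow> real \<Rightarrow> real \<Rightarrow> (int \<Rightarrow> real grid_fun) \<Rightarrow> (int \<Rightarrow> real) \<Rightarrow> bool"
  where "sav_solution K a dt \<phi> r \<longleftrightarrow>
    (\<forall>n\<ge>-1. \<phi> n \<in> grid_space K) \<and>
    \<phi> (-1) = (\<lambda>i j k. \<phi> 0 i j k - dt * grid_lap K (init_potential K a (\<phi> 0)) i j k) \<and>
    r 0 = sqrt (E1 K (\<phi> 0)) \<and>
    r (-1) = sqrt (E1 K (\<phi> (-1))) \<and>
    (\<forall>n\<ge>0. sav_step K a dt (\<phi> (n + 1)) (\<phi> n) (\<phi> (n - 1)) (r (n + 1)) (r n) (r (n - 1)))"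

definition modified_energy ::
  "nat \<Rightarrow> real \<Rightarrow> real grid_fun \<Rightarrow> real grid_fun \<Rightarrow> real \<Rightarrow> real \<Rightarrow> real"
  where "modified_energy K a \<phi>' \<phi> r' r =
    1 / 4 * ((grid_norm K 2 (lin_sqrt K a \<phi>'))\<^sup>2
      + (grid_norm K 2 (lin_sqrt K a (\<lambda>i j k. 2 * \<phi>' i j k - \<phi> i j k)))\<^sup>2)
    + 1 / 2 * (\<bar>r'\<bar>\<^sup>2 + \<bar>2 * r' - r\<bar>\<^sup>2)"

lemma wave_orthogonality:
  "(\<Sum>l\<in>{- int K..int K}. cis (2 * pi * of_int l * of_int d * mesh K))
    = (if int (num K) dvd d then of_nat (num K) else 0)"
proof -
  define w where "w = cis (2 * pi * of_int d * mesh K)"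
  have N: "real (num K) * mesh K = 1" by (simp add: mesh_def num_def)
  have "w ^ num K = cis (2 * pi * of_int d * (real (num K) * mesh K))"
    by (simp add: w_def Complex.DeMoivre mult_ac)
  also have "\<dots> = 1"
    by (simp add: N cis_multiple_2pi)
  finally have wN: "w ^ num K = 1" .
  have w1: "w = 1 \<longleftrightarrow> int (num K) dvd d"
  proof
    assume "w = 1"
    then have "cos (2 * pi * of_int d * mesh K) = 1"
      by (auto simp: w_def complex_eq_iff)
    then obtain q :: int where "2 * pi * of_int d * mesh K = of_int q * 2 * pi"
      using cos_one_2pi_int by metis
    then have "of_int d * mesh K = of_int q" by simp
    then have "of_int d = (of_int q * real (num K) :: real)"
      by (simp add: mesh_def field_simps num_def split: if_splits)
    then have "real_of_int d = real_of_int (q * int (num K))" by simp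
    then have "d = q * int (num K)" by (simp only: of_int_eq_iff)
    then show "int (num K) dvd d" by simp
  next
    assume "int (num K) dvd d"
    then obtain q where "d = int (num K) * q" by (elim dvdE)
    then have "2 * pi * of_int d * mesh K = 2 * pi * of_int q * (real (num K) * mesh K)" by simp
    then have "w = cis (2 * pi * of_int q)" by (simp only: w_def N mult_1_right)
    then show "w = 1" by (simp add: cis_multiple_2pi)
  qed
  have "(\<Sum>l\<in>{- int K..int K}. cis (2 * pi * of_int l * of_int d * mesh K))
      = (\<Sum>t<num K. cis (2 * pi * of_int (int t - int K) * of_int d * mesh K))"
    by (rule sum.reindex_bij_witness[of _ "\<lambda>t. int t - int K" "\<lambda>l. nat (l + int K)"])
      (auto simp: num_def)
  also have "\<dots> = (\<Sum>t<num K. cis (- (2 * pi * real K * of_int d * mesh K)) * w ^ t)"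
    by (intro sum.cong refl)
      (simp add: w_def Complex.DeMoivre cis_mult algebra_simps)
  also have "\<dots> = cis (- (2 * pi * real K * of_int d * mesh K)) * (\<Sum>t<num K. w ^ t)"
    by (simp add: sum_distrib_left)
  finally have eq: "(\<Sum>l\<in>{- int K..int K}. cis (2 * pi * of_int l * of_int d * mesh K))
      = cis (- (2 * pi * real K * of_int d * mesh K)) * (\<Sum>t<num K. w ^ t)" .
  show ?thesis
  proof (cases "w = 1")
    case True
    then obtain q where q: "d = int (num K) * q" using w1 by (auto elim: dvdE)
    have "cis (2 * pi * of_int l * of_int d * mesh K) = 1" for l :: int
    proof -
      have "2 * pi * of_int l * of_int d * mesh K = 2 * pi * of_int (l * q) * (real (num K) * mesh K)"
        by (simp add: q)
      then show ?thesis by (simp only: N) (simp add: cis_multiple_2pi flip: of_int_mult)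
    qed
    then show ?thesis using True w1 by (simp add: num_def)
  next
    case False
    then have "(\<Sum>t<num K. w ^ t) = 0" using wN by (simp add: geometric_sum)
    then show ?thesis using eq False w1 by simp
  qed
qed

lemma fourier_expansion_1d:
  fixes g :: "int \<Rightarrow> complex"
  assumes per: "\<And>i. g (i + int (num K)) = g i"
  shows "g i = (\<Sum>l\<in>{- int K..int K}. of_real (mesh K) *
    (\<Sum>i'\<in>{0..<int (num K)}. g i' * cis (2 * pi * of_int l * of_int (i - i') * mesh K)))"
proof -
  have N: "int (num K) > 0" by (simp add: num_def)
  have perm: "g (i mod int (num K)) = g i"
  proof -
    have up: "g (x + int n * int (num K)) = g x" for x n
    proof (induction n)
      case (Suc n)
      have "g (x + int (Suc n) * int (num K)) = g ((x + int n * int (num K)) + int (num K))"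
        by (simp add: algebra_simps)
      then show ?case using per Suc by simp
    qed simp
    have any: "g (x + q * int (num K)) = g x" for x q
    proof (cases "q \<ge> 0")
      case True
      then show ?thesis using up[of x "nat q"] by simp
    next
      case False
      then show ?thesis using up[of "x + q * int (num K)" "nat (- q)"] by simp
    qed
    show ?thesis using any[of "i mod int (num K)" "i div int (num K)"] by simp
  qed
  have "(\<Sum>l\<in>{- int K..int K}. of_real (mesh K) *
      (\<Sum>i'\<in>{0..<int (num K)}. g i' * cis (2 * pi * of_int l * of_int (i - i') * mesh K)))
    = of_real (mesh K) * (\<Sum>i'\<in>{0..<int (num K)}. g i' *
        (\<Sum>l\<in>{- int K..int K}. cis (2 * pi * of_int l * of_int (i - i') * mesh K)))"
    unfolding sum_distrib_left[symmetric]
    by (subst sum.swap) (simp only: sum_distrib_left)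
  also have "\<dots> = of_real (mesh K) * (\<Sum>i'\<in>{0..<int (num K)}.
      if i' = i mod int (num K) then g i' * of_nat (num K) else 0)"
  proof -
    have "int (num K) dvd i - i' \<longleftrightarrow> i' = i mod int (num K)"
      if "i' \<in> {0..<int (num K)}" for i'
      using that by (simp add: mod_eq_dvd_iff[symmetric]) (auto simp: eq_commute)
    then show ?thesis
      by (intro arg_cong[where f = "\<lambda>x. of_real (mesh K) * x"] sum.cong refl)
        (simp add: wave_orthogonality del: of_int_diff)
  qed
  also have "\<dots> = g (i mod int (num K))"
    using N by (simp add: sum.delta mesh_def)
  finally show ?thesis using perm by simp
qed

lemma wave_cis:
  "wave K l m n i j k = cis (2 * pi * of_int l * of_int i * mesh K)
    * cis (2 * pi * of_int m * of_int j * mesh K) * cis (2 * pi * of_int n * of_int k * mesh K)"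
  by (simp add: wave_def cis_conv_exp exp_add[symmetric] algebra_simps)

lemma fourier_expansion:
  assumes "f \<in> grid_space K"
  shows "of_real (f i j k) = freq_sum K (\<lambda>l m n. fourier_coeff K f l m n * wave K l m n i j k)"
proof -
  let ?L = "{- int K..int K}" and ?I = "{0..<int (num K)}" and ?h = "of_real (mesh K) :: complex"
  let ?e = "\<lambda>(l::int) (d::int). cis (2 * pi * of_int l * of_int d * mesh K)"
  let ?f = "\<lambda>i j k. of_real (f i j k) :: complex"
  have e: "?e l (x - y) = ?e l x * cnj (?e l y)" for l x y
    by (simp add: cis_cnj cis_mult algebra_simps)
  have p: "f (i + int (num K)) j k = f i j k" "f i (j + int (num K)) k = f i j k"
    "f i j (k + int (num K)) = f i j k" for i j k
    using assms by (auto simp: grid_space_def)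
  have "?f i j k = (\<Sum>l\<in>?L. ?h * (\<Sum>i'\<in>?I. ?f i' j k * ?e l (i - i')))"
    by (rule fourier_expansion_1d) (simp add: p)
  also have "\<dots> = (\<Sum>l\<in>?L. ?h * (\<Sum>i'\<in>?I.
      (\<Sum>m\<in>?L. ?h * (\<Sum>j'\<in>?I. ?f i' j' k * ?e m (j - j'))) * ?e l (i - i')))"
    by (subst fourier_expansion_1d[where g = "\<lambda>j. ?f _ j _"]) (simp_all add: p)
  also have "\<dots> = (\<Sum>l\<in>?L. ?h * (\<Sum>i'\<in>?I.
      (\<Sum>m\<in>?L. ?h * (\<Sum>j'\<in>?I.
        (\<Sum>n\<in>?L. ?h * (\<Sum>k'\<in>?I. ?f i' j' k' * ?e n (k - k'))) * ?e m (j - j'))) * ?e l (i - i')))"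
    by (subst fourier_expansion_1d[where g = "\<lambda>k. ?f _ _ k"]) (simp_all add: p)
  also have "\<dots> = (\<Sum>l\<in>?L. \<Sum>i'\<in>?I. \<Sum>m\<in>?L. \<Sum>j'\<in>?I. \<Sum>n\<in>?L. \<Sum>k'\<in>?I.
      ?h ^ 3 * ?f i' j' k' * (?e n (k - k') * ?e m (j - j') * ?e l (i - i')))"
    by (simp only: sum_distrib_left sum_distrib_right power3_eq_cube mult_ac)
  also have "\<dots> = (\<Sum>l\<in>?L. \<Sum>m\<in>?L. \<Sum>n\<in>?L. \<Sum>i'\<in>?I. \<Sum>j'\<in>?I. \<Sum>k'\<in>?I.
      ?h ^ 3 * ?f i' j' k' * (?e n (k - k') * ?e m (j - j') * ?e l (i - i')))"
  proof -
    have "(\<Sum>i'\<in>?I. \<Sum>m\<in>?L. \<Sum>j'\<in>?I. \<Sum>n\<in>?L. \<Sum>k'\<in>?I. G i' m j' n k')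
      = (\<Sum>m\<in>?L. \<Sum>n\<in>?L. \<Sum>i'\<in>?I. \<Sum>j'\<in>?I. \<Sum>k'\<in>?I. G i' m j' n k')"
      for G :: "int \<Rightarrow> int \<Rightarrow> int \<Rightarrow> int \<Rightarrow> int \<Rightarrow> complex"
    proof -
      have "(\<Sum>i'\<in>?I. \<Sum>m\<in>?L. \<Sum>j'\<in>?I. \<Sum>n\<in>?L. \<Sum>k'\<in>?I. G i' m j' n k')
        = (\<Sum>m\<in>?L. \<Sum>i'\<in>?I. \<Sum>n\<in>?L. \<Sum>j'\<in>?I. \<Sum>k'\<in>?I. G i' m j' n k')"
        by (subst sum.swap) (intro sum.cong refl sum.swap)
      also have "\<dots> = (\<Sum>m\<in>?L. \<Sum>n\<in>?L. \<Sum>i'\<in>?I. \<Sum>j'\<in>?I. \<Sum>k'\<in>?I. G i' m j' n k')"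
        by (intro sum.cong refl sum.swap)
      finally show ?thesis .
    qed
    then show ?thesis by (rule sum.cong[OF refl])
  qed
  also have "\<dots> = freq_sum K (\<lambda>l m n. fourier_coeff K f l m n * wave K l m n i j k)"
    unfolding freq_sum_def fourier_coeff_def grid_sum_def wave_cis e
    by (simp only: sum_distrib_left sum_distrib_right of_real_power complex_cnj_mult mult_ac)
  finally show ?thesis .
qed

lemma fourier_mult_complex:
  assumes sym: "\<And>l m n. \<sigma> (- l) (- m) (- n) = cnj (\<sigma> l m n)"
  shows "of_real (fourier_mult K \<sigma> f i j k)
    = freq_sum K (\<lambda>l m n. \<sigma> l m n * fourier_coeff K f l m n * wave K l m n i j k)"
    (is "_ = freq_sum K ?F")
proof -
  have w: "wave K (- l) (- m) (- n) i j k = cnj (wave K l m n i j k)" for l m n i j k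
    by (simp add: wave_cis cis_cnj)
  have c: "fourier_coeff K f (- l) (- m) (- n) = cnj (fourier_coeff K f l m n)" for l m n
    by (simp add: fourier_coeff_def grid_sum_def w)
  have neg: "(\<Sum>l\<in>{- int K..int K}. g (- l)) = (\<Sum>l\<in>{- int K..int K}. g l)"
    for g :: "int \<Rightarrow> complex"
    by (rule sum.reindex_bij_witness[of _ uminus uminus]) auto
  have neg3: "freq_sum K (\<lambda>l m n. G (- l) (- m) (- n)) = freq_sum K G" for G :: "complex grid_fun"
  proof -
    let ?L = "{- int K..int K}"
    have "freq_sum K (\<lambda>l m n. G (- l) (- m) (- n)) = (\<Sum>l\<in>?L. \<Sum>m\<in>?L. \<Sum>n\<in>?L. G l (- m) (- n))"
      unfolding freq_sum_def by (rule neg[of "\<lambda>l. \<Sum>m\<in>?L. \<Sum>n\<in>?L. G l (- m) (- n)"])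
    also have "\<dots> = (\<Sum>l\<in>?L. \<Sum>m\<in>?L. \<Sum>n\<in>?L. G l m (- n))"
      by (rule sum.cong[OF refl]) (rule neg[of "\<lambda>m. \<Sum>n\<in>?L. G l m (- n)" for l])
    also have "\<dots> = freq_sum K G"
      unfolding freq_sum_def by (rule sum.cong[OF refl], rule sum.cong[OF refl]) (rule neg[of "G l m" for l m])
    finally show ?thesis .
  qed
  have "cnj (freq_sum K ?F) = freq_sum K (\<lambda>l m n. ?F (- l) (- m) (- n))"
    by (simp add: freq_sum_def sym w c)
  also have "\<dots> = freq_sum K ?F"
    by (rule neg3[of ?F])
  finally have "freq_sum K ?F \<in> \<real>"
    unfolding Reals_cnj_iff .
  then show ?thesis
    unfolding fourier_mult_def by (rule of_real_Re)
qed

end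

theory Submission
  imports Defs
begin

text \<open>
  The proof is the energy method. Write \<open>\<mu>\<close> for the argument of the outer Laplacian in the
  first equation of the scheme, so that the difference quotient of the grid functions is
  \<open>\<Delta>\<^sub>N \<mu>\<close>. Pairing this equation with \<open>\<mu>\<close> gives \<open>\<langle>\<Delta>\<^sub>N \<mu>, \<mu>\<rangle> = - \<parallel>\<nabla>\<^sub>N \<mu>\<parallel>\<^sup>2 \<le> 0\<close>
  (\<open>grid_inner_lap_nonpos\<close>). On the other side the explicit nonlinear term and the equation for
  the auxiliary variable contain the same pairing of the nonlinearity with the difference
  quotient, so the former can be replaced by twice the new auxiliary value times its difference
  quotient.

  What remains are two pairings of a new value with its own second-order difference quotient, one
  for the auxiliary variable and one, after moving half of the linear operator to the other
  factor, for the functions obtained from the solution by \<open>L\<^sub>N\<^sup>1\<^sup>/\<^sup>2\<close>. Each of them is bounded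
  below, up to a positive factor, by the increment of the corresponding part of the energy
  (\<open>bdf2_energy_increment\<close>).

  The operators are Fourier multipliers. Parseval's identity makes the derivatives skew-adjoint
  and the square root self-adjoint (\<open>grid_inner_fourier_mult_adjoint\<close>), and orthogonality of the
  waves on the grid turns composition into multiplication of symbols
  (\<open>fourier_mult_compose\<close>), so that the square root really squares to the linear operator.
\<close>

section \<open>Sums over the grid\<close>

lemma grid_sum_cartesian:
  "grid_sum K f = (\<Sum>(i, j, k)\<in>{0..<int (num K)} \<times> {0..<int (num K)} \<times> {0..<int (num K)}. f i j k)"
  by (simp add: grid_sum_def sum.cartesian_product)

lemma freq_sum_cartesian:
  "freq_sum K F = (\<Sum>(l, m, n)\<in>{- int K..int K} \<times> {- int K..int K} \<times> {- int K..int K}. F l m n)"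
  by (simp add: freq_sum_def sum.cartesian_product)

lemma grid_sum_freq_sum_swap:
  "grid_sum K (\<lambda>i j k. freq_sum K (\<lambda>l m n. G i j k l m n))
    = freq_sum K (\<lambda>l m n. grid_sum K (\<lambda>i j k. G i j k l m n))"
  unfolding grid_sum_cartesian freq_sum_cartesian split_def by (rule sum.swap)

lemma grid_sum_mult_left:
  fixes c :: "'a::semiring_0"
  shows "c * grid_sum K f = grid_sum K (\<lambda>i j k. c * f i j k)"
  by (simp add: grid_sum_def sum_distrib_left)

lemma freq_sum_mult_left:
  fixes c :: "'a::semiring_0"
  shows "c * freq_sum K f = freq_sum K (\<lambda>i j k. c * f i j k)"
  by (simp add: freq_sum_def sum_distrib_left)

lemma freq_sum_mult_right:
  fixes c :: "'a::semiring_0"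
  shows "freq_sum K f * c = freq_sum K (\<lambda>i j k. f i j k * c)"
  by (simp add: freq_sum_def sum_distrib_right)

lemma grid_sum_add: "grid_sum K (\<lambda>i j k. f i j k + g i j k) = grid_sum K f + grid_sum K g"
  by (simp add: grid_sum_def sum.distrib)

lemma freq_sum_add: "freq_sum K (\<lambda>i j k. f i j k + g i j k) = freq_sum K f + freq_sum K g"
  by (simp add: freq_sum_def sum.distrib)

lemma freq_sum_cong:
  assumes "\<And>l m n. l \<in> {- int K..int K} \<Longrightarrow> m \<in> {- int K..int K} \<Longrightarrow> n \<in> {- int K..int K}
    \<Longrightarrow> F l m n = G l m n"
  shows "freq_sum K F = freq_sum K G"
  unfolding freq_sum_def using assms by (intro sum.cong refl) auto

lemma grid_sum_product:
  fixes u v w :: "int \<Rightarrow> 'a::comm_semiring_0"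
  shows "grid_sum K (\<lambda>i j k. u i * v j * w k)
    = sum u {0..<int (num K)} * sum v {0..<int (num K)} * sum w {0..<int (num K)}"
proof -
  have "sum u I * sum v J * sum w L = (\<Sum>i\<in>I. \<Sum>j\<in>J. \<Sum>k\<in>L. u i * v j * w k)"
    for I J L :: "int set"
  proof -
    have "sum u I * sum v J * sum w L = (\<Sum>i\<in>I. \<Sum>j\<in>J. (u i * v j) * sum w L)"
      by (subst sum_product) (simp only: sum_distrib_right)
    then show ?thesis
      by (simp only: sum_distrib_left)
  qed
  then show ?thesis
    unfolding grid_sum_def ..
qed

section \<open>The discrete inner product\<close>

lemma mesh_pos: "mesh K > 0"
  by (simp add: mesh_def num_def)

lemma grid_inner_commute: "grid_inner K f g = grid_inner K g f"
  by (simp add: grid_inner_def mult.commute)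

lemma grid_inner_add_left:
  "grid_inner K (\<lambda>i j k. f i j k + g i j k) u = grid_inner K f u + grid_inner K g u"
  by (simp add: grid_inner_def distrib_left distrib_right grid_sum_add)

lemma grid_inner_scale_left:
  "grid_inner K (\<lambda>i j k. c * f i j k) u = c * grid_inner K f u"
  by (simp add: grid_inner_def grid_sum_mult_left mult_ac)

lemma grid_inner_uminus_right:
  "grid_inner K u (\<lambda>i j k. - f i j k) = - grid_inner K u f"
  by (simp add: grid_inner_def grid_sum_def sum_negf)

lemma grid_inner_self_nonneg: "grid_inner K f f \<ge> 0"
  unfolding grid_inner_def grid_sum_def
  by (intro mult_nonneg_nonneg sum_nonneg zero_le_power zero_le_square less_imp_le[OF mesh_pos])

lemma grid_norm_2_power2:
  fixes f :: "real grid_fun"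
  shows "(grid_norm K 2 f)\<^sup>2 = grid_inner K f f"
proof -
  have *: "\<bar>x\<bar> powr 2 = x * x" for x :: real
    by (simp add: powr_numeral power2_eq_square)
  have "grid_norm K 2 f = sqrt (grid_inner K f f)"
    using grid_inner_self_nonneg[of K f]
    by (simp add: grid_norm_def grid_inner_def * powr_half_sqrt)
  then show ?thesis
    using grid_inner_self_nonneg[of K f] by simp
qed

section \<open>Fourier multipliers\<close>

lemma fourier_coeff_linear:
  "fourier_coeff K (\<lambda>i j k. \<alpha> * f i j k + \<beta> * g i j k) l m n
    = of_real \<alpha> * fourier_coeff K f l m n + of_real \<beta> * fourier_coeff K g l m n"
  by (simp add: fourier_coeff_def distrib_right distrib_left grid_sum_add grid_sum_mult_left mult_ac)

lemma fourier_mult_linear: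
  "fourier_mult K \<sigma> (\<lambda>i j k. \<alpha> * f i j k + \<beta> * g i j k)
    = (\<lambda>i j k. \<alpha> * fourier_mult K \<sigma> f i j k + \<beta> * fourier_mult K \<sigma> g i j k)"
proof -
  have "fourier_mult K \<sigma> (\<lambda>i j k. \<alpha> * f i j k + \<beta> * g i j k) i j k
    = Re (of_real \<alpha> * freq_sum K (\<lambda>l m n. \<sigma> l m n * fourier_coeff K f l m n * wave K l m n i j k)
      + of_real \<beta> * freq_sum K (\<lambda>l m n. \<sigma> l m n * fourier_coeff K g l m n * wave K l m n i j k))"
    for i j k
    unfolding fourier_mult_def fourier_coeff_linear freq_sum_mult_left freq_sum_add[symmetric]
    by (simp add: algebra_simps)
  then show ?thesis
    by (intro ext) (simp add: fourier_mult_def[of K \<sigma> f] fourier_mult_def[of K \<sigma> g])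
qed

lemma fourier_mult_symbol_linear:
  "\<alpha> * fourier_mult K \<sigma> f i j k + \<beta> * fourier_mult K \<tau> f i j k
    = fourier_mult K (\<lambda>l m n. of_real \<alpha> * \<sigma> l m n + of_real \<beta> * \<tau> l m n) f i j k"
proof -
  have "fourier_mult K (\<lambda>l m n. of_real \<alpha> * \<sigma> l m n + of_real \<beta> * \<tau> l m n) f i j k
    = Re (of_real \<alpha> * freq_sum K (\<lambda>l m n. \<sigma> l m n * fourier_coeff K f l m n * wave K l m n i j k)
      + of_real \<beta> * freq_sum K (\<lambda>l m n. \<tau> l m n * fourier_coeff K f l m n * wave K l m n i j k))"
    unfolding fourier_mult_def freq_sum_mult_left freq_sum_add[symmetric]
    by (simp add: algebra_simps)
  then show ?thesis
    by (simp add: fourier_mult_def)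
qed

lemma fourier_mult_one:
  assumes "f \<in> grid_space K"
  shows "fourier_mult K (\<lambda>l m n. 1) f = f"
proof (intro ext)
  fix i j k
  show "fourier_mult K (\<lambda>l m n. 1) f i j k = f i j k"
    by (simp add: fourier_mult_def fourier_expansion[OF assms, symmetric])
qed

text \<open>Parseval's identity. Since the second function is real, summing it against a wave over the
  grid gives the conjugate of its Fourier coefficient, so that exchanging the two sums is enough.\<close>

lemma grid_inner_fourier_mult:
  "grid_inner K (fourier_mult K \<sigma> f) g
    = Re (freq_sum K (\<lambda>l m n. \<sigma> l m n * fourier_coeff K f l m n * cnj (fourier_coeff K g l m n)))"
proof -
  let ?S = "\<lambda>i j k. freq_sum K (\<lambda>l m n. \<sigma> l m n * fourier_coeff K f l m n * wave K l m n i j k)"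
  have "grid_inner K (fourier_mult K \<sigma> f) g
    = Re (of_real (mesh K ^ 3) * grid_sum K (\<lambda>i j k. ?S i j k * of_real (g i j k)))"
    by (simp add: grid_inner_def fourier_mult_def grid_sum_def del: of_real_power)
  also have "of_real (mesh K ^ 3) * grid_sum K (\<lambda>i j k. ?S i j k * of_real (g i j k))
    = freq_sum K (\<lambda>l m n. \<sigma> l m n * fourier_coeff K f l m n * cnj (fourier_coeff K g l m n))"
  proof -
    have c: "cnj (fourier_coeff K g l m n)
      = of_real (mesh K ^ 3) * grid_sum K (\<lambda>i j k. of_real (g i j k) * wave K l m n i j k)" for l m n
      by (simp add: fourier_coeff_def grid_sum_def)
    show ?thesis
      unfolding c freq_sum_mult_right grid_sum_freq_sum_swap freq_sum_mult_left
      by (simp only: grid_sum_mult_left mult_ac)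
  qed
  finally show ?thesis .
qed

lemma grid_inner_fourier_mult_adjoint:
  "grid_inner K (fourier_mult K \<sigma> f) g
    = grid_inner K f (fourier_mult K (\<lambda>l m n. cnj (\<sigma> l m n)) g)"
proof -
  have "grid_inner K f (fourier_mult K (\<lambda>l m n. cnj (\<sigma> l m n)) g)
    = Re (cnj (freq_sum K (\<lambda>l m n. cnj (\<sigma> l m n) * fourier_coeff K g l m n
        * cnj (fourier_coeff K f l m n))))"
    by (subst grid_inner_commute) (simp add: grid_inner_fourier_mult)
  also have "\<dots> = grid_inner K (fourier_mult K \<sigma> f) g"
    unfolding grid_inner_fourier_mult freq_sum_def
    by (simp only: cnj_sum complex_cnj_mult complex_cnj_cnj mult_ac)
  finally show ?thesis ..
qed

text \<open>Both index ranges are complete systems of residues, so the orthogonality relation summed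
  over frequencies also holds when summed over grid points.\<close>

lemma grid_orthogonality_1d:
  "(\<Sum>i\<in>{0..<int (num K)}. cis (2 * pi * of_int d * of_int i * mesh K))
    = (if int (num K) dvd d then of_nat (num K) else 0)"
proof -
  have N: "real (num K) * mesh K = 1" by (simp add: mesh_def num_def)
  have shift: "cis (2 * pi * of_int (i + int (num K)) * of_int d * mesh K)
      = cis (2 * pi * of_int i * of_int d * mesh K)" for i
  proof -
    have "2 * pi * of_int (i + int (num K)) * of_int d * mesh K
        = 2 * pi * of_int i * of_int d * mesh K + 2 * pi * of_int d * (real (num K) * mesh K)"
      by (simp add: algebra_simps)
    then have "cis (2 * pi * of_int (i + int (num K)) * of_int d * mesh K)
        = cis (2 * pi * of_int i * of_int d * mesh K) * cis (2 * pi * of_int d)"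
      by (simp only: N mult_1_right flip: cis_mult)
    then show ?thesis
      by (simp add: cis_multiple_2pi)
  qed
  have "(\<Sum>i\<in>{0..<int (num K)}. cis (2 * pi * of_int i * of_int d * mesh K))
    = (\<Sum>i\<in>{- int K..int K}. cis (2 * pi * of_int i * of_int d * mesh K))"
  proof (rule sum.reindex_bij_witness[of _
        "\<lambda>i. if i < 0 then i + int (num K) else i" "\<lambda>i. if i \<le> int K then i else i - int (num K)"])
    fix i assume "i \<in> {0..<int (num K)}"
    show "cis (2 * pi * of_int (if i \<le> int K then i else i - int (num K)) * of_int d * mesh K)
      = cis (2 * pi * of_int i * of_int d * mesh K)"
      using shift[of "i - int (num K)"] by simp
  qed (auto simp: num_def)
  then show ?thesis
    unfolding wave_orthogonality by (simp only: mult_ac)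
qed

lemma wave_grid_orthogonality:
  assumes "{l, m, n, l', m', n'} \<subseteq> {- int K..int K}"
  shows "of_real (mesh K ^ 3) * grid_sum K (\<lambda>i j k. wave K l' m' n' i j k * cnj (wave K l m n i j k))
    = (if (l', m', n') = (l, m, n) then 1 else 0)"
proof -
  let ?e = "\<lambda>d i :: int. cis (2 * pi * of_int d * of_int i * mesh K)"
  have prod: "wave K l' m' n' i j k * cnj (wave K l m n i j k)
      = ?e (l' - l) i * ?e (m' - m) j * ?e (n' - n) k" for i j k
    by (simp add: wave_cis cis_cnj cis_mult algebra_simps)
  \<comment> \<open>Distinct admissible frequencies differ by at most \<open>2K\<close>, which is less than the period.\<close>
  have sep: "int (num K) dvd p - q \<longleftrightarrow> p = q"
    if "p \<in> {- int K..int K}" "q \<in> {- int K..int K}" for p q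
  proof
    assume "int (num K) dvd p - q"
    moreover have "\<bar>p - q\<bar> < int (num K)"
      using that by (auto simp: num_def)
    ultimately show "p = q"
      using dvd_imp_le_int[of "p - q" "int (num K)"] by auto
  qed simp
  have sum1: "(\<Sum>i\<in>{0..<int (num K)}. ?e (p - q) i) = (if p = q then of_nat (num K) else 0)"
    if "p \<in> {- int K..int K}" "q \<in> {- int K..int K}" for p q
    unfolding grid_orthogonality_1d by (simp only: sep[OF that])
  have "complex_of_real (mesh K ^ 3) * (of_nat (num K) * of_nat (num K) * of_nat (num K)) = 1"
  proof -
    have "mesh K ^ 3 * (real (num K) * real (num K) * real (num K)) = (real (num K) * mesh K) ^ 3"
      by (simp add: power3_eq_cube)
    also have "\<dots> = 1"
      by (simp add: mesh_def num_def)
    finally have "complex_of_real (mesh K ^ 3 * (real (num K) * real (num K) * real (num K))) = 1"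
      by (simp only: of_real_1)
    then show ?thesis
      by (simp only: of_real_mult of_real_of_nat_eq)
  qed
  moreover have "grid_sum K (\<lambda>i j k. wave K l' m' n' i j k * cnj (wave K l m n i j k))
    = (if l' = l then of_nat (num K) else 0) * (if m' = m then of_nat (num K) else 0)
      * (if n' = n then of_nat (num K) else 0)"
    unfolding prod grid_sum_product using assms by (simp only: sum1 insert_subset)
  ultimately show ?thesis
    by (simp del: of_real_power)
qed

text \<open>The Hermitian symmetry of the symbol ensures that taking the real part in the definition of a
  multiplier discards nothing; after that, orthogonality of the waves picks out one frequency.\<close>

lemma fourier_coeff_fourier_mult:
  assumes "\<And>l m n. \<tau> (- l) (- m) (- n) = cnj (\<tau> l m n)"
    and lmn: "l \<in> {- int K..int K}" "m \<in> {- int K..int K}" "n \<in> {- int K..int K}"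
  shows "fourier_coeff K (fourier_mult K \<tau> f) l m n = \<tau> l m n * fourier_coeff K f l m n"
proof -
  let ?F = "\<lambda>l m n. \<tau> l m n * fourier_coeff K f l m n"
  let ?L = "{- int K..int K}"
  have "fourier_coeff K (fourier_mult K \<tau> f) l m n
    = of_real (mesh K ^ 3) * grid_sum K (\<lambda>i j k.
        freq_sum K (\<lambda>l' m' n'. ?F l' m' n' * wave K l' m' n' i j k) * cnj (wave K l m n i j k))"
    unfolding fourier_coeff_def[of K "fourier_mult K \<tau> f"] fourier_mult_complex[of \<tau>, OF assms(1)] ..
  also have "\<dots> = freq_sum K (\<lambda>l' m' n'. ?F l' m' n' * (of_real (mesh K ^ 3) *
      grid_sum K (\<lambda>i j k. wave K l' m' n' i j k * cnj (wave K l m n i j k))))"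
    unfolding freq_sum_mult_right grid_sum_freq_sum_swap freq_sum_mult_left
    by (simp only: grid_sum_mult_left mult_ac)
  also have "\<dots> = freq_sum K (\<lambda>l' m' n'. if (l', m', n') = (l, m, n) then ?F l' m' n' else 0)"
    by (rule freq_sum_cong) (use lmn in \<open>simp add: wave_grid_orthogonality del: of_real_power\<close>)
  also have "\<dots> = (\<Sum>p\<in>?L \<times> ?L \<times> ?L.
      if p = (l, m, n) then ?F (fst p) (fst (snd p)) (snd (snd p)) else 0)"
    by (simp add: freq_sum_cartesian split_def prod_eq_iff)
  also have "\<dots> = ?F l m n"
    using lmn by (subst sum.delta) auto
  finally show ?thesis .
qed

lemma fourier_mult_compose:
  assumes "\<And>l m n. \<tau> (- l) (- m) (- n) = cnj (\<tau> l m n)"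
  shows "fourier_mult K \<sigma> (fourier_mult K \<tau> f) = fourier_mult K (\<lambda>l m n. \<sigma> l m n * \<tau> l m n) f"
proof (intro ext)
  fix i j k
  show "fourier_mult K \<sigma> (fourier_mult K \<tau> f) i j k
    = fourier_mult K (\<lambda>l m n. \<sigma> l m n * \<tau> l m n) f i j k"
    unfolding fourier_mult_def[of K \<sigma>] fourier_mult_def[of K "\<lambda>l m n. \<sigma> l m n * \<tau> l m n"]
    by (intro arg_cong[of _ _ Re] freq_sum_cong)
      (simp add: fourier_coeff_fourier_mult[of \<tau>, OF assms])
qed

section \<open>The Laplacian and the linear operator\<close>

lemma grid_inner_fourier_mult_skew:
  assumes "\<And>l m n. cnj (\<sigma> l m n) = - \<sigma> l m n"
  shows "grid_inner K (fourier_mult K \<sigma> f) g = - grid_inner K f (fourier_mult K \<sigma> g)"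
proof -
  have "fourier_mult K (\<lambda>l m n. - \<sigma> l m n) g = (\<lambda>i j k. - fourier_mult K \<sigma> g i j k)"
    by (intro ext) (simp add: fourier_mult_def freq_sum_def sum_negf)
  then show ?thesis
    by (simp add: grid_inner_fourier_mult_adjoint[of K \<sigma>] assms grid_inner_uminus_right)
qed

lemma grid_lap_derivatives:
  "grid_lap K f = (\<lambda>i j k. Dx K (Dx K f) i j k + Dy K (Dy K f) i j k + Dz K (Dz K f) i j k)"
  unfolding grid_lap_def grid_div_def grid_grad_def by simp

lemma grid_inner_lap_nonpos: "grid_inner K (grid_lap K f) f \<le> 0"
proof -
  have "grid_inner K (grid_lap K f) f = - grid_inner K (Dx K f) (Dx K f)
      - grid_inner K (Dy K f) (Dy K f) - grid_inner K (Dz K f) (Dz K f)"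
    unfolding grid_lap_derivatives grid_inner_add_left Dx_def Dy_def Dz_def
    by (simp add: grid_inner_fourier_mult_skew)
  then show ?thesis
    using grid_inner_self_nonneg[of K "Dx K f"] grid_inner_self_nonneg[of K "Dy K f"]
      grid_inner_self_nonneg[of K "Dz K f"] by linarith
qed

lemma grid_lap_fourier_mult:
  "grid_lap K f = fourier_mult K (\<lambda>l m n. - of_real (lambda l m n)) f"
proof (intro ext)
  fix i j k
  let ?x = "\<lambda>l m n :: int. 2 * of_real pi * \<i> * of_int l :: complex"
  let ?y = "\<lambda>l m n :: int. 2 * of_real pi * \<i> * of_int m :: complex"
  let ?z = "\<lambda>l m n :: int. 2 * of_real pi * \<i> * of_int n :: complex"
  \<comment> \<open>The unit factors bring the sum into the form of nested linear combinations of symbols.\<close>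
  have "grid_lap K f i j k = 1 * (1 * fourier_mult K (\<lambda>l m n. ?x l m n * ?x l m n) f i j k
      + 1 * fourier_mult K (\<lambda>l m n. ?y l m n * ?y l m n) f i j k)
      + 1 * fourier_mult K (\<lambda>l m n. ?z l m n * ?z l m n) f i j k"
    by (simp add: grid_lap_derivatives Dx_def Dy_def Dz_def fourier_mult_compose)
  also have "\<dots> = fourier_mult K (\<lambda>l m n. - of_real (lambda l m n)) f i j k"
    unfolding fourier_mult_symbol_linear
    by (rule arg_cong[of _ _ "\<lambda>\<sigma>. fourier_mult K \<sigma> f i j k"])
      (auto simp: fun_eq_iff lambda_def power2_eq_square algebra_simps)
  finally show "grid_lap K f i j k = fourier_mult K (\<lambda>l m n. - of_real (lambda l m n)) f i j k" .
qed

text \<open>Periodicity is what makes the term \<open>a \<phi>\<close> a Fourier multiplier at all: a multiplier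
  reads the values on one period only and returns a periodic function.\<close>

lemma lin_sqrt_lin_sqrt:
  assumes "f \<in> grid_space K" and "a \<ge> 0"
  shows "lin_sqrt K a (lin_sqrt K a f) = lin K a f"
proof (intro ext)
  fix i j k
  have even: "lambda (- l) (- m) (- n) = lambda l m n" for l m n
    by (simp add: lambda_def)
  have root: "complex_of_real (sqrt (a + (lambda l m n)\<^sup>2)) * of_real (sqrt (a + (lambda l m n)\<^sup>2))
      = of_real a + of_real (lambda l m n) * of_real (lambda l m n)" for l m n
  proof -
    have "sqrt (a + (lambda l m n)\<^sup>2) * sqrt (a + (lambda l m n)\<^sup>2)
        = a + lambda l m n * lambda l m n"
      using assms(2) by (simp add: power2_eq_square)
    then show ?thesis
      by (simp only: flip: of_real_mult of_real_add)
  qed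
  have "lin K a f i j k = a * fourier_mult K (\<lambda>l m n. 1) f i j k
      + 1 * fourier_mult K (\<lambda>l m n. of_real (lambda l m n) * of_real (lambda l m n)) f i j k"
    using assms(1) by (simp add: lin_def grid_lap_fourier_mult fourier_mult_compose even fourier_mult_one)
  also have "\<dots> = lin_sqrt K a (lin_sqrt K a f) i j k"
    unfolding fourier_mult_symbol_linear
    by (simp add: lin_sqrt_def fourier_mult_compose even root)
  finally show "lin_sqrt K a (lin_sqrt K a f) i j k = lin K a f i j k" ..
qed

lemma grid_inner_lin:
  assumes "f \<in> grid_space K" and "a \<ge> 0"
  shows "grid_inner K (lin K a f) g = grid_inner K (lin_sqrt K a f) (lin_sqrt K a g)"
proof -
  have "grid_inner K (lin K a f) g = grid_inner K (lin_sqrt K a (lin_sqrt K a f)) g"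
    using assms by (simp add: lin_sqrt_lin_sqrt)
  also have "\<dots> = grid_inner K (lin_sqrt K a f) (lin_sqrt K a g)"
    unfolding lin_sqrt_def[of K a] by (subst grid_inner_fourier_mult_adjoint) simp
  finally show ?thesis .
qed

section \<open>Dissipation of the modified energy\<close>

text \<open>The difference of the two sides is the square of the second difference \<open>u - 2 v + w\<close>;
  this is the G-stability of the second-order backward difference formula.\<close>

lemma bdf2_energy_increment:
  assumes "dt > 0"
  shows "(u\<^sup>2 + (2 * u - v)\<^sup>2) - (v\<^sup>2 + (2 * v - w)\<^sup>2) \<le> 4 * dt * (u * bdf2 dt u v w)"
proof -
  have "4 * dt * (u * bdf2 dt u v w) = 2 * u * (3 * u - 4 * v + w)"
    using assms by (simp add: bdf2_def field_simps)
  also have "\<dots> = (u\<^sup>2 + (2 * u - v)\<^sup>2) - (v\<^sup>2 + (2 * v - w)\<^sup>2) + (u - 2 * v + w)\<^sup>2"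
    by (simp add: power2_eq_square algebra_simps)
  finally show ?thesis
    by simp
qed

lemma grid_inner_bdf2_energy_increment:
  assumes "dt > 0"
  shows "(grid_inner K u u + grid_inner K (\<lambda>i j k. 2 * u i j k - v i j k) (\<lambda>i j k. 2 * u i j k - v i j k))
      - (grid_inner K v v + grid_inner K (\<lambda>i j k. 2 * v i j k - w i j k) (\<lambda>i j k. 2 * v i j k - w i j k))
    \<le> 4 * dt * grid_inner K u (\<lambda>i j k. bdf2 dt (u i j k) (v i j k) (w i j k))"
proof -
  have "grid_sum K (\<lambda>i j k. ((u i j k)\<^sup>2 + (2 * u i j k - v i j k)\<^sup>2)
        - ((v i j k)\<^sup>2 + (2 * v i j k - w i j k)\<^sup>2))
      \<le> grid_sum K (\<lambda>i j k. 4 * dt * (u i j k * bdf2 dt (u i j k) (v i j k) (w i j k)))"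
    unfolding grid_sum_def by (intro sum_mono bdf2_energy_increment assms)
  then have "mesh K ^ 3 * grid_sum K (\<lambda>i j k. ((u i j k)\<^sup>2 + (2 * u i j k - v i j k)\<^sup>2)
        - ((v i j k)\<^sup>2 + (2 * v i j k - w i j k)\<^sup>2))
      \<le> mesh K ^ 3 * grid_sum K (\<lambda>i j k. 4 * dt * (u i j k * bdf2 dt (u i j k) (v i j k) (w i j k)))"
    using mesh_pos[of K] by (intro mult_left_mono) auto
  moreover have "mesh K ^ 3 * grid_sum K (\<lambda>i j k. ((u i j k)\<^sup>2 + (2 * u i j k - v i j k)\<^sup>2)
        - ((v i j k)\<^sup>2 + (2 * v i j k - w i j k)\<^sup>2))
      = (grid_inner K u u + grid_inner K (\<lambda>i j k. 2 * u i j k - v i j k) (\<lambda>i j k. 2 * u i j k - v i j k))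
      - (grid_inner K v v + grid_inner K (\<lambda>i j k. 2 * v i j k - w i j k) (\<lambda>i j k. 2 * v i j k - w i j k))"
    unfolding grid_inner_def power2_eq_square grid_sum_def sum_subtractf sum.distrib
    by (simp only: distrib_left right_diff_distrib)
  moreover have "mesh K ^ 3 * grid_sum K (\<lambda>i j k. 4 * dt * (u i j k * bdf2 dt (u i j k) (v i j k) (w i j k)))
      = 4 * dt * grid_inner K u (\<lambda>i j k. bdf2 dt (u i j k) (v i j k) (w i j k))"
    unfolding grid_inner_def grid_sum_mult_left[symmetric] by simp
  ultimately show ?thesis
    by simp
qed

lemma lin_sqrt_bdf2:
  "lin_sqrt K a (\<lambda>i j k. bdf2 dt (u i j k) (v i j k) (w i j k))
    = (\<lambda>i j k. bdf2 dt (lin_sqrt K a u i j k) (lin_sqrt K a v i j k) (lin_sqrt K a w i j k))"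
proof -
  have bdf2_comb: "bdf2 dt x y z = 1 / dt * (3 / 2 * x + (- 2) * y) + 1 / (2 * dt) * z" for x y z
    by (simp add: bdf2_def add_divide_distrib diff_divide_distrib)
  show ?thesis
    unfolding bdf2_comb lin_sqrt_def fourier_mult_linear ..
qed

lemma lin_sqrt_extrapolate:
  "lin_sqrt K a (\<lambda>i j k. 2 * u i j k - v i j k)
    = (\<lambda>i j k. 2 * lin_sqrt K a u i j k - lin_sqrt K a v i j k)"
  using fourier_mult_linear[of K _ 2 u "- 1" v] by (simp add: lin_sqrt_def)

text \<open>The nonlinear term has no sign of its own. It enters both equations of the scheme with the
  same weight \<open>c\<close>, so the second equation trades its pairing with the difference quotient \<open>d\<close> for
  a pairing of the auxiliary values, to which the backward difference estimate applies.\<close>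

lemma sav_step_energy_dissipation:
  assumes step: "sav_step K a dt \<phi>' \<phi> \<psi> r' r s"
    and "\<phi>' \<in> grid_space K" and "a \<ge> 0" and dt: "dt > 0"
  shows "modified_energy K a \<phi>' \<phi> r' r \<le> modified_energy K a \<phi> \<psi> r s"
proof -
  define c where "c = 1 / sqrt (E1 K (extrapolate \<phi> \<psi>))"
  define g where "g = nonlin K (extrapolate \<phi> \<psi>)"
  define d where "d = (\<lambda>i j k. bdf2 dt (\<phi>' i j k) (\<phi> i j k) (\<psi> i j k))"
  define \<mu> where "\<mu> = (\<lambda>i j k. r' * c * g i j k + lin K a \<phi>' i j k)"
  let ?A = "lin_sqrt K a \<phi>'" and ?B = "lin_sqrt K a \<phi>" and ?C = "lin_sqrt K a \<psi>"
  have d: "d = grid_lap K \<mu>" and r: "bdf2 dt r' r s = c / 2 * grid_inner K g d"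
    using step by (simp_all add: sav_step_def Let_def c_def g_def d_def \<mu>_def)
  have "grid_inner K \<mu> d = r' * c * grid_inner K g d + grid_inner K (lin K a \<phi>') d"
    unfolding \<mu>_def grid_inner_add_left grid_inner_scale_left ..
  also have "r' * c * grid_inner K g d = 2 * (r' * bdf2 dt r' r s)"
    by (simp add: r)
  also have "grid_inner K (lin K a \<phi>') d
      = grid_inner K ?A (\<lambda>i j k. bdf2 dt (?A i j k) (?B i j k) (?C i j k))"
    using assms by (simp add: grid_inner_lin d_def lin_sqrt_bdf2)
  finally have "2 * (r' * bdf2 dt r' r s)
      + grid_inner K ?A (\<lambda>i j k. bdf2 dt (?A i j k) (?B i j k) (?C i j k)) \<le> 0"
    using grid_inner_lap_nonpos[of K \<mu>] by (simp add: d grid_inner_commute[of K \<mu>])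
  then have "dt * (2 * (r' * bdf2 dt r' r s)
      + grid_inner K ?A (\<lambda>i j k. bdf2 dt (?A i j k) (?B i j k) (?C i j k))) \<le> 0"
    using dt by (intro mult_nonneg_nonpos) auto
  then have "2 * (4 * dt * (r' * bdf2 dt r' r s))
      + 4 * dt * grid_inner K ?A (\<lambda>i j k. bdf2 dt (?A i j k) (?B i j k) (?C i j k)) \<le> 0"
    by (simp add: algebra_simps)
  then show ?thesis
    using bdf2_energy_increment[OF dt, of r' r s] grid_inner_bdf2_energy_increment[OF dt, of K ?A ?B ?C]
    unfolding modified_energy_def grid_norm_2_power2 lin_sqrt_extrapolate power2_abs by argo
qed

theorem theorem3p1:
  fixes K :: nat and \<epsilon> a dt :: real
    and \<phi> :: "int \<Rightarrow> real grid_fun" and r :: "int \<Rightarrow> real" and k :: int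
  assumes "0 < \<epsilon>" and "\<epsilon> < 1" and "a = 1 - \<epsilon>"
    and "dt > 0"
    and "sav_solution K a dt \<phi> r"
    and "k \<ge> 1"
  shows "modified_energy K a (\<phi> (k + 1)) (\<phi> k) (r (k + 1)) (r k)
    \<le> modified_energy K a (\<phi> k) (\<phi> (k - 1)) (r k) (r (k - 1))"
proof (rule sav_step_energy_dissipation)
  show "sav_step K a dt (\<phi> (k + 1)) (\<phi> k) (\<phi> (k - 1)) (r (k + 1)) (r k) (r (k - 1))"
    and "\<phi> (k + 1) \<in> grid_space K"
    using assms by (auto simp: sav_solution_def)
qed (use assms in auto)

end
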